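(* Fix a constant $c\in(0,1/2]$ (independent of $U$). For $U\in\{2,3,\dots\}$ let $W(U),X(U),Y(U)\ge 2$ be integers with $W(U)\le U^2$, such that $$\limsup_{U\to\infty}\frac{\log X(U)}{\log U}<\infty\qquad\text{and}\qquad \limsup_{U\to\infty}\frac{\log Y(U)}{\log U}<3 .$$ For each $U$, let $\bm{A}=\bm{A}_U$ be any $c$-balanced target function $a\colon\{0,\dots,U-1\}^2\to\{0,\dots,W(U)-1\}$ whose $U\times U$ matrix has no two identical rows and no two identical columns. Let $\mathcal{G}(X,Y)$ denote the set of all functions $g\colon\{0,\dots,X-1\}\times\{0,\dots,X-1\}\to\{0,\dots,Y-1\}$. Then $$\lim_{U\to\infty}\frac{\bigl|\{\bm{G}\in\mathcal{G}(X(U),Y(U)) : (\bm{A},\bm{G})\text{ is }0\text{-feasible}\}\bigr|}{|\mathcal{G}(X(U),Y(U))|}=0 .$$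
   Context: A target function is a map $a\colon\mathcal{U}\times\mathcal{U}\to\mathcal{W}$ with $\mathcal{U}=\{0,\dots,U-1\}$, $\mathcal{W}=\{0,\dots,W-1\}$, identified with its $U\times U$ matrix $\bm{A}$. A (deterministic two-user multiple-access) channel is a map $g\colon\mathcal{X}\times\mathcal{X}\to\mathcal{Y}$ with $\mathcal{X}=\{0,\dots,X-1\}$, $\mathcal{Y}=\{0,\dots,Y-1\}$, identified with its $X\times X$ matrix $\bm{G}$. The pair $(\bm{A},\bm{G})$ is $0$-feasible if there exist encoders $f_1,f_2\colon\mathcal{U}\to\mathcal{X}$ and a decoder $\phi\colon\mathcal{Y}\to\mathcal{W}$ such that $\phi(g(f_1(u_1),f_2(u_2)))=a(u_1,u_2)$ for all $u_1,u_2\in\mathcal{U}$ (i.e. probability of error $0$ for independent uniform messages). For $\widetilde{\mathcal{W}}\subset\mathcal{W}$ let $a^{-1}(\widetilde{\mathcal{W}})=\{(u_1,u_2)\in\mathcal{U}\times\mathcal{U}: a(u_1,u_2)\in\widetilde{\mathcal{W}}\}$. For $c\in(0,1/2]$, $a$ is $c$-balanced if there is a partition $\mathcal{W}_1,\mathcal{W}_2$ of $\mathcal{W}$ such that $|a^{-1}(\mathcal{W}_i)|\ge cU^2$ for $i\in\{1,2\}$. *)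

theory Defs
  imports "HOL-Analysis.Analysis"
begin

text \<open>
  The alphabet \<open>{0, \<dots>, n-1}\<close> is \<open>{..<n}\<close>. Maps on pairs are taken extensional
  (equal to \<open>undefined\<close> off their domain), so that \<open>channels X Y\<close> is finite and has
  exactly \<open>Y ^ X\<^sup>2\<close> elements.
\<close>

definition target_functions :: "nat \<Rightarrow> nat \<Rightarrow> (nat \<times> nat \<Rightarrow> nat) set" where
  "target_functions U W = ({..<U} \<times> {..<U}) \<rightarrow>\<^sub>E {..<W}"

definition channels :: "nat \<Rightarrow> nat \<Rightarrow> (nat \<times> nat \<Rightarrow> nat) set" where
  "channels X Y = ({..<X} \<times> {..<X}) \<rightarrow>\<^sub>E {..<Y}"

definition zero_feasible ::
  "nat \<Rightarrow> nat \<Rightarrow> nat \<Rightarrow> nat \<Rightarrow> (nat \<times> nat \<Rightarrow> nat) \<Rightarrow> (nat \<times> nat \<Rightarrow> nat) \<Rightarrow> bool" where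
  "zero_feasible U W X Y a g \<longleftrightarrow>
     (\<exists>f1 \<in> {..<U} \<rightarrow> {..<X}. \<exists>f2 \<in> {..<U} \<rightarrow> {..<X}. \<exists>\<phi> \<in> {..<Y} \<rightarrow> {..<W}.
        \<forall>u1 \<in> {..<U}. \<forall>u2 \<in> {..<U}. \<phi> (g (f1 u1, f2 u2)) = a (u1, u2))"

definition target_preimage :: "nat \<Rightarrow> (nat \<times> nat \<Rightarrow> nat) \<Rightarrow> nat set \<Rightarrow> (nat \<times> nat) set" where
  "target_preimage U a V = {p \<in> {..<U} \<times> {..<U}. a p \<in> V}"

text \<open>
  Nonemptiness of the two classes need not be demanded: it follows from the cardinality
  bounds whenever \<open>c > 0\<close> and \<open>U > 0\<close>.
\<close>

definition balanced :: "real \<Rightarrow> nat \<Rightarrow> nat \<Rightarrow> (nat \<times> nat \<Rightarrow> nat) \<Rightarrow> bool" where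
  "balanced c U W a \<longleftrightarrow>
     (\<exists>W1 W2. W1 \<union> W2 = {..<W} \<and> W1 \<inter> W2 = {} \<and>
        real (card (target_preimage U a W1)) \<ge> c * (real U)\<^sup>2 \<and>
        real (card (target_preimage U a W2)) \<ge> c * (real U)\<^sup>2)"

definition distinct_rows :: "nat \<Rightarrow> (nat \<times> nat \<Rightarrow> nat) \<Rightarrow> bool" where
  "distinct_rows U a \<longleftrightarrow>
     (\<forall>u \<in> {..<U}. \<forall>u' \<in> {..<U}. u \<noteq> u' \<longrightarrow> (\<exists>v \<in> {..<U}. a (u, v) \<noteq> a (u', v)))"

definition distinct_columns :: "nat \<Rightarrow> (nat \<times> nat \<Rightarrow> nat) \<Rightarrow> bool" where
  "distinct_columns U a \<longleftrightarrow>
     (\<forall>v \<in> {..<U}. \<forall>v' \<in> {..<U}. v \<noteq> v' \<longrightarrow> (\<exists>u \<in> {..<U}. a (u, v) \<noteq> a (u, v')))"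

end

theory Submission
  imports Defs "HOL-Real_Asymp.Real_Asymp"
begin

text \<open>
  Distinct rows and columns force both encoders to be injective, so for fixed encoders a random
  channel assigns independent uniform values to the cells reached from each of the two balanced
  classes. A decoder exists only if these two sets of values are disjoint. Exposing
  the \<open>N\<^sub>1\<close> values of the first class one at a time and following the moment
  \<open>exp (- \<lambda> |T|)\<close> of the set \<open>T\<close> of values seen so far, with \<open>\<lambda> = N\<^sub>2 / Y\<close>, bounds the
  probability of disjointness by \<open>((1 + exp (- \<lambda>)) / 2) ^ N\<^sub>1 + (1 / 2) ^ N\<^sub>2\<close>.
  For \<open>Y \<le> U powr s\<close> with \<open>2 \<le> s < 3\<close> this is at most \<open>2 exp (- c\<^sup>2 U powr (4 - s) / 4)\<close>,
  which beats the number \<open>X ^ (2 U) = exp (O (U ln U))\<close> of encoder pairs.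
\<close>

section \<open>Counting functions coordinate by coordinate\<close>

lemma card_PiE_insert_Collect:
  assumes "x \<notin> D" "finite D" "finite B"
  shows "card {g \<in> insert x D \<rightarrow>\<^sub>E B. P g} = (\<Sum>y\<in>B. card {g \<in> D \<rightarrow>\<^sub>E B. P (g(x := y))})"
proof -
  let ?S = "SIGMA y:B. {g \<in> D \<rightarrow>\<^sub>E B. P (g(x := y))}"
  have "bij_betw (\<lambda>(y, g). g(x := y)) ?S {g \<in> insert x D \<rightarrow>\<^sub>E B. P g}"
    unfolding bij_betw_def
  proof
    have "inj_on (\<lambda>(y, g). g(x := y)) (B \<times> (D \<rightarrow>\<^sub>E B))"
      using inj_combinator[OF assms(1), of "\<lambda>_. B"] by simp
    then show "inj_on (\<lambda>(y, g). g(x := y)) ?S"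
      by (rule inj_on_subset) auto
    show "(\<lambda>(y, g). g(x := y)) ` ?S = {g \<in> insert x D \<rightarrow>\<^sub>E B. P g}"
      unfolding PiE_insert_eq by force
  qed
  then have "card {g \<in> insert x D \<rightarrow>\<^sub>E B. P g} = card ?S"
    by (rule bij_betw_same_card[symmetric])
  then show ?thesis
    using assms by (simp add: card_SigmaI finite_PiE)
qed

text \<open>Integrates out the coordinates that an event does not depend on: each is chosen freely
  and contributes one factor \<open>card B\<close>.\<close>

lemma card_PiE_irrelevant:
  assumes "finite R" "finite D" "finite B" "R \<inter> D = {}"
    and "\<And>g x y. x \<in> R \<Longrightarrow> P (g(x := y)) = P g"
  shows "card {g \<in> R \<union> D \<rightarrow>\<^sub>E B. P g} = card B ^ card R * card {g \<in> D \<rightarrow>\<^sub>E B. P g}"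
  using assms(1,4,5)
proof (induction R rule: finite_induct)
  case (insert x R)
  have P: "P (g(x := y)) = P g" for g y
    using insert.prems(2) by blast
  have "card {g \<in> insert x (R \<union> D) \<rightarrow>\<^sub>E B. P g}
      = (\<Sum>y\<in>B. card {g \<in> R \<union> D \<rightarrow>\<^sub>E B. P (g(x := y))})"
    using insert assms(2,3) by (intro card_PiE_insert_Collect) auto
  also have "\<dots> = card B * card {g \<in> R \<union> D \<rightarrow>\<^sub>E B. P g}"
    by (simp only: P sum_constant of_nat_id)
  also have "card {g \<in> R \<union> D \<rightarrow>\<^sub>E B. P g} = card B ^ card R * card {g \<in> D \<rightarrow>\<^sub>E B. P g}"
    using insert.prems by (intro insert.IH) auto
  finally show ?case
    using insert.hyps by simp
qed simp

section \<open>Disjointness of the values on two blocks of cells\<close>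

lemma card_PiE_avoiding:
  assumes "finite R" "finite I" "finite B" "R \<inter> I = {}" "T \<subseteq> B"
  shows "card {g \<in> R \<union> I \<rightarrow>\<^sub>E B. T \<inter> g ` I = {}} = card B ^ card R * (card B - card T) ^ card I"
proof -
  have "x \<in> R \<Longrightarrow> (T \<inter> (g(x := y)) ` I = {}) = (T \<inter> g ` I = {})" for g :: "'a \<Rightarrow> 'b" and x y
    using assms(4) by (auto simp: image_def)
  moreover have "{g \<in> I \<rightarrow>\<^sub>E B. T \<inter> g ` I = {}} = I \<rightarrow>\<^sub>E (B - T)"
    by (auto simp: PiE_iff extensional_def)
  ultimately show ?thesis
    using assms by (subst card_PiE_irrelevant) (auto simp: card_PiE card_Diff_subset finite_subset)
qed

text \<open>\<open>T\<close> collects the values already exposed, all of which \<open>J\<close> has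
  to avoid, and it must vary in the induction on \<open>I\<close>. The potential
  \<open>exp (- l * card T)\<close> shrinks by \<open>exp (- l)\<close> when a new value appears and
  stays put on a repetition. While \<open>T\<close> fills less than half of \<open>B\<close>, the
  expected factor is at most \<open>q\<close>; from then on the values on \<open>J\<close> avoid
  \<open>T\<close> with probability at most \<open>(1/2) ^ card J\<close>, which is the additive
  term. Both sides are multiplied by the total number of functions.\<close>

lemma card_PiE_disjoint_images_aux:
  fixes l q :: real
  assumes "finite I" "finite J" "finite B" "B \<noteq> {}" "I \<inter> J = {}" "T \<subseteq> B"
    and l: "l = card J / card B" and q: "q = (1 + exp (- l)) / 2"
  shows "real (card {g \<in> I \<union> J \<rightarrow>\<^sub>E B. (T \<union> g ` I) \<inter> g ` J = {}})
    \<le> real (card B) ^ (card I + card J) * (q ^ card I * exp (- l * card T) + (1/2) ^ card J)"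
  using assms(1,5,6)
proof (induction I arbitrary: T rule: finite_induct)
  case empty
  have B: "real (card B) > 0"
    using assms by (simp add: card_gt_0_iff)
  have T: "card T \<le> card B"
    using empty assms by (simp add: card_mono)
  have "real (card {g \<in> J \<rightarrow>\<^sub>E B. T \<inter> g ` J = {}}) = (real (card B) - card T) ^ card J"
    using card_PiE_avoiding[of "{}" J B T] empty assms T by (simp add: of_nat_diff)
  also have "\<dots> = real (card B) ^ card J * (1 - card T / card B) ^ card J"
    using B by (simp add: power_mult_distrib[symmetric] field_simps)
  \<comment> \<open>This is \<open>1 - x <= exp (- x)\<close> at \<open>x = card T / card B\<close>.
    Raising it to the power \<open>card J\<close> produces the exponent \<open>l * card T\<close>,
    which explains the choice of \<open>l\<close>.\<close>
  also have "\<dots> \<le> real (card B) ^ card J * exp (- (card T / card B)) ^ card J"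
    using B T exp_ge_add_one_self[of "- (card T / card B)"] by (intro mult_left_mono power_mono) (auto simp: field_simps)
  also have "\<dots> = real (card B) ^ card J * exp (- l * card T)"
    by (simp add: l exp_of_nat_mult[symmetric])
  also have "\<dots> \<le> real (card B) ^ card J * (exp (- l * card T) + (1/2) ^ card J)"
    by (intro mult_left_mono) auto
  finally show ?case
    by simp
next
  case (insert x I)
  define Z where "Z = real (card B)"
  define n where "n = card I"
  define m where "m = card J"
  define t where "t = real (card T)"
  have Z: "Z > 0"
    using assms by (simp add: Z_def card_gt_0_iff)
  have finT: "finite T"
    using insert assms finite_subset by blast
  have tZ: "t \<le> Z"
    using insert assms by (simp add: Z_def t_def card_mono)
  have q0: "q \<ge> 0"
    unfolding q by simp
  have fJ: "(g(x := y)) ` J = g ` J" for y and g :: "'a \<Rightarrow> 'b"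
    using insert by (auto simp: image_def)
  have fI: "(g(x := y)) ` insert x I = insert y (g ` I)" for y and g :: "'a \<Rightarrow> 'b"
    using insert by (auto simp: image_def)
  show ?case
  proof (cases "t < Z / 2")
    case False
    \<comment> \<open>\<open>T\<close> alone is now large enough, so the remaining values on
      \<open>I\<close> are left free and only the avoidance of \<open>T\<close> is kept.\<close>
    have "{g \<in> insert x I \<union> J \<rightarrow>\<^sub>E B. (T \<union> g ` insert x I) \<inter> g ` J = {}}
        \<subseteq> {g \<in> insert x I \<union> J \<rightarrow>\<^sub>E B. T \<inter> g ` J = {}}"
      by auto
    then have "card {g \<in> insert x I \<union> J \<rightarrow>\<^sub>E B. (T \<union> g ` insert x I) \<inter> g ` J = {}}
        \<le> card {g \<in> insert x I \<union> J \<rightarrow>\<^sub>E B. T \<inter> g ` J = {}}"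
      using insert assms by (intro card_mono) (auto intro!: finite_PiE)
    also have "\<dots> = card B ^ card (insert x I) * (card B - card T) ^ card J"
      using insert assms by (intro card_PiE_avoiding) auto
    finally have "real (card {g \<in> insert x I \<union> J \<rightarrow>\<^sub>E B. (T \<union> g ` insert x I) \<inter> g ` J = {}})
        \<le> real (card B ^ card (insert x I) * (card B - card T) ^ card J)"
      by (rule of_nat_mono)
    also have "\<dots> = Z ^ Suc n * (Z - t) ^ m"
      using insert tZ by (simp add: Z_def n_def m_def t_def of_nat_diff)
    also have "\<dots> \<le> Z ^ Suc n * (Z / 2) ^ m"
      using False tZ Z by (intro mult_left_mono power_mono) auto
    also have "\<dots> = Z ^ (Suc n + m) * (1/2) ^ m"
      by (simp add: power_add power_divide)
    also have "\<dots> \<le> Z ^ (Suc n + m) * (q ^ Suc n * exp (- l * t) + (1/2) ^ m)"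
      using Z q0 by (intro mult_left_mono) auto
    finally show ?thesis
      using insert by (simp add: Z_def n_def m_def t_def)
  next
    case True
    define C where "C = Z ^ (n + m)"
    have C: "C \<ge> 0" using Z by (simp add: C_def)
    have "card {g \<in> insert x I \<union> J \<rightarrow>\<^sub>E B. (T \<union> g ` insert x I) \<inter> g ` J = {}}
        = (\<Sum>y\<in>B. card {g \<in> I \<union> J \<rightarrow>\<^sub>E B.
            (T \<union> (g(x := y)) ` insert x I) \<inter> (g(x := y)) ` J = {}})"
      unfolding Un_insert_left using insert assms by (intro card_PiE_insert_Collect) auto
    also have "\<dots> = (\<Sum>y\<in>B. card {g \<in> I \<union> J \<rightarrow>\<^sub>E B. (insert y T \<union> g ` I) \<inter> g ` J = {}})"
      by (simp only: fI fJ Un_insert_left Un_insert_right)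
    finally have "real (card {g \<in> insert x I \<union> J \<rightarrow>\<^sub>E B. (T \<union> g ` insert x I) \<inter> g ` J = {}})
        = (\<Sum>y\<in>B. real (card {g \<in> I \<union> J \<rightarrow>\<^sub>E B. (insert y T \<union> g ` I) \<inter> g ` J = {}}))"
      by simp
    \<comment> \<open>Conditioned on the value \<open>y\<close> at \<open>x\<close>, the induction
      hypothesis applies with \<open>insert y T\<close>. The sum over \<open>y\<close> is then split
      into repeated values (\<open>y\<close> in \<open>T\<close>) and new ones.\<close>
    also have "\<dots> \<le> (\<Sum>y\<in>B. C * (q ^ n * exp (- l * card (insert y T)) + (1/2) ^ m))"
      unfolding C_def Z_def n_def m_def using insert by (intro sum_mono insert.IH) auto
    also have "\<dots> = C * (q ^ n * (\<Sum>y\<in>B. exp (- l * card (insert y T))) + Z * (1/2) ^ m)"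
      by (simp add: sum.distrib sum_distrib_left distrib_left Z_def)
    also have "(\<Sum>y\<in>B. exp (- l * card (insert y T)))
        = (\<Sum>y\<in>T. exp (- l * card (insert y T))) + (\<Sum>y\<in>B - T. exp (- l * card (insert y T)))"
      using insert.prems(2) assms(3) by (subst sum.subset_diff[of T B]) (auto simp: add.commute)
    also have "(\<Sum>y\<in>T. exp (- l * card (insert y T))) = t * exp (- l * t)"
      by (simp add: t_def insert_absorb)
    also have "(\<Sum>y\<in>B - T. exp (- l * card (insert y T))) = (\<Sum>y\<in>B - T. exp (- l) * exp (- l * t))"
      using finT by (intro sum.cong) (auto simp: t_def exp_add[symmetric] algebra_simps)
    also have "\<dots> = (Z - t) * (exp (- l) * exp (- l * t))"
      using insert finT assms by (simp add: card_Diff_subset of_nat_diff card_mono Z_def t_def)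
    also have "t * exp (- l * t) + (Z - t) * (exp (- l) * exp (- l * t))
        = (t + (Z - t) * exp (- l)) * exp (- l * t)"
      by (simp add: algebra_simps)
    also have "C * (q ^ n * \<dots> + Z * (1/2) ^ m)
        \<le> C * (q ^ n * (Z * q * exp (- l * t)) + Z * (1/2) ^ m)"
    proof -
      \<comment> \<open>This product is exactly the difference
        \<open>Z * q - (t + (Z - t) * exp (- l))\<close>; its sign is the reason for the threshold
        \<open>Z / 2\<close>.\<close>
      have "0 \<le> (Z / 2 - t) * (1 - exp (- l))"
        using True l by (intro mult_nonneg_nonneg) auto
      then have "t + (Z - t) * exp (- l) \<le> Z * q"
        by (simp add: q field_simps)
      then show ?thesis
        using C q0 by (intro mult_left_mono add_right_mono mult_right_mono) auto
    qed
    also have "\<dots> = Z ^ (Suc n + m) * (q ^ Suc n * exp (- l * t) + (1/2) ^ m)"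
      by (simp add: C_def algebra_simps)
    finally show ?thesis
      using insert by (simp add: Z_def n_def m_def t_def)
  qed
qed

text \<open>The start \<open>T = {}\<close> of the exposure, where the potential is 1; cells outside
  both blocks are integrated out.\<close>

lemma card_PiE_disjoint_images:
  fixes l :: real
  assumes "finite D" "finite B" "B \<noteq> {}" "I \<subseteq> D" "J \<subseteq> D" "I \<inter> J = {}"
    and l: "l = card J / card B"
  shows "real (card {g \<in> D \<rightarrow>\<^sub>E B. g ` I \<inter> g ` J = {}})
    \<le> real (card B) ^ card D * (((1 + exp (- l)) / 2) ^ card I + (1/2) ^ card J)"
proof -
  define R where "R = D - (I \<union> J)"
  have D: "D = R \<union> (I \<union> J)"
    using assms by (auto simp: R_def)
  have fin: "finite R" "finite I" "finite J"
    using assms by (auto simp: R_def intro: finite_subset)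
  have cD: "card D = card R + (card I + card J)"
    unfolding D using fin assms(6) by (subst card_Un_disjoint) (auto simp: R_def card_Un_disjoint)
  have irr: "((g(x := y)) ` I \<inter> (g(x := y)) ` J = {}) = (g ` I \<inter> g ` J = {})"
    if "x \<in> R" for g :: "'a \<Rightarrow> 'b" and x y
  proof -
    have "(g(x := y)) ` I = g ` I" "(g(x := y)) ` J = g ` J"
      using that by (auto simp: R_def image_def)
    then show ?thesis by simp
  qed
  have "card {g \<in> D \<rightarrow>\<^sub>E B. g ` I \<inter> g ` J = {}}
      = card B ^ card R * card {g \<in> I \<union> J \<rightarrow>\<^sub>E B. g ` I \<inter> g ` J = {}}"
    unfolding D using fin assms(2) irr by (intro card_PiE_irrelevant) (auto simp: R_def)
  moreover have "real (card {g \<in> I \<union> J \<rightarrow>\<^sub>E B. g ` I \<inter> g ` J = {}})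
      \<le> real (card B) ^ (card I + card J) * (((1 + exp (- l)) / 2) ^ card I + (1/2) ^ card J)"
    using card_PiE_disjoint_images_aux[of I J B "{}" l] fin assms by simp
  ultimately show ?thesis
    by (simp add: cD power_add mult.assoc mult_left_mono)
qed

section \<open>Exponential form of the disjointness bound\<close>

lemma half_one_plus_exp_le:
  fixes l :: real
  assumes "l \<ge> 0"
  shows "(1 + exp (- l)) / 2 \<le> exp (- (min l 1 / 4))"
proof -
  \<comment> \<open>The cut-off at 1 gives \<open>m * m <= m\<close>, hence
    \<open>(1 - m / 2) * (1 + m) = 1 + (m - m * m) / 2 >= 1\<close>.\<close>
  define m where "m = min l 1"
  have m: "0 \<le> m" "m \<le> 1" "m \<le> l"
    using assms by (auto simp: m_def)
  have "m * m \<le> m * 1"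
    using m by (intro mult_left_mono) auto
  then have "1 \<le> (1 - m / 2) * (1 + m)"
    by (simp add: algebra_simps)
  also have "\<dots> \<le> (1 - m / 2) * exp m"
    using m exp_ge_add_one_self[of m] by (intro mult_left_mono) auto
  finally have "exp (- m) \<le> 1 - m / 2"
    by (simp add: exp_minus field_simps)
  moreover have "exp (- l) \<le> exp (- m)"
    using m by simp
  ultimately have "exp (- l) \<le> 1 - m / 2"
    by (rule order_trans[rotated])
  then have "(1 + exp (- l)) / 2 \<le> 1 + - (m / 4)"
    by (simp add: field_simps)
  also have "\<dots> \<le> exp (- (m / 4))"
    by (rule exp_ge_add_one_self)
  finally show ?thesis
    by (simp add: m_def)
qed

text \<open>Merges both terms into one exponential in a common lower bound \<open>b\<close> for the
  block sizes. The first term decays at rate \<open>min l 1 / 4\<close> per cell with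
  \<open>l >= b / y\<close>; the second is at most \<open>exp (- (b / 2))\<close>, which suffices
  because the minimum is at most 1.\<close>

lemma disjoint_images_bound:
  fixes l b :: real
  assumes "b \<le> card I" "b \<le> card J" "0 \<le> b" "l = card J / y" "0 < y"
  shows "((1 + exp (- l)) / 2) ^ card I + (1/2) ^ card J \<le> 2 * exp (- (b * min (b / y) 1 / 4))"
proof -
  have l0: "l \<ge> 0" "b / y \<le> l" using assms by (auto simp: divide_right_mono)
  have "((1 + exp (- l)) / 2) ^ card I \<le> exp (- (min l 1 / 4)) ^ card I"
    using half_one_plus_exp_le[OF l0(1)] by (intro power_mono) (auto simp: add_nonneg_nonneg)
  also have "\<dots> = exp (- (card I * min l 1 / 4))"
    by (simp add: exp_of_nat_mult[symmetric])
  also have "\<dots> \<le> exp (- (b * min (b / y) 1 / 4))"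
  proof -
    have "b * min (b / y) 1 \<le> card I * min l 1"
      using assms l0 by (intro mult_mono) auto
    then show ?thesis by simp
  qed
  finally have 1: "((1 + exp (- l)) / 2) ^ card I \<le> exp (- (b * min (b / y) 1 / 4))" .
  have "(1/2::real) \<le> exp (- (1/2))"
    using exp_ge_add_one_self[of "- (1/2)"] by simp
  then have "(1/2::real) ^ card J \<le> exp (- (1/2)) ^ card J"
    by (intro power_mono) auto
  also have "\<dots> = exp (- (card J / 2))"
    by (simp add: exp_of_nat_mult[symmetric])
  also have "\<dots> \<le> exp (- (b * min (b / y) 1 / 4))"
  proof -
    have "b * min (b / y) 1 \<le> b * 1"
      using assms by (intro mult_left_mono) auto
    then show ?thesis using assms by simp
  qed
  finally show ?thesis using 1 by simp
qed

section \<open>Union bound over the encoders\<close>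

lemma zero_feasibleE:
  assumes "zero_feasible U W X Y a g" "distinct_rows U a" "distinct_columns U a"
  obtains f1 f2 \<phi> where "f1 \<in> {..<U} \<rightarrow>\<^sub>E {..<X}" "f2 \<in> {..<U} \<rightarrow>\<^sub>E {..<X}"
    "inj_on f1 {..<U}" "inj_on f2 {..<U}"
    "\<And>u v. u < U \<Longrightarrow> v < U \<Longrightarrow> \<phi> (g (f1 u, f2 v)) = a (u, v)"
proof -
  obtain f1 f2 \<phi> where f: "f1 \<in> {..<U} \<rightarrow> {..<X}" "f2 \<in> {..<U} \<rightarrow> {..<X}"
    and \<phi>: "\<And>u v. u < U \<Longrightarrow> v < U \<Longrightarrow> \<phi> (g (f1 u, f2 v)) = a (u, v)"
    using assms(1) unfolding zero_feasible_def by blast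
  \<comment> \<open>Two messages sharing a channel input would give identical rows of the target
    matrix; likewise for columns below.\<close>
  have "inj_on f1 {..<U}"
    using assms(2) \<phi> unfolding distinct_rows_def inj_on_def by (metis lessThan_iff)
  moreover have "inj_on f2 {..<U}"
    using assms(3) \<phi> unfolding distinct_columns_def inj_on_def by (metis lessThan_iff)
  \<comment> \<open>Restriction makes the encoders extensional, so that they range over a finite set
    that can be counted.\<close>
  ultimately show thesis
    using f \<phi> that[of "restrict f1 {..<U}" "restrict f2 {..<U}" \<phi>] by (auto simp: inj_on_def)
qed

lemma card_zero_feasible_le:
  assumes "0 \<le> c" "0 < Y" and bal: "balanced c U W a" and rows: "distinct_rows U a"
    and cols: "distinct_columns U a"
  shows "real (card {g \<in> channels X Y. zero_feasible U W X Y a g}) / real (card (channels X Y))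
    \<le> real X ^ (2 * U) * (2 * exp (- (c * (real U)\<^sup>2 * min (c * (real U)\<^sup>2 / real Y) 1 / 4)))"
    (is "_ \<le> _ * ?e")
proof -
  obtain W1 W2 where W: "W1 \<inter> W2 = {}"
    and N: "c * (real U)\<^sup>2 \<le> card (target_preimage U a W1)"
      "c * (real U)\<^sup>2 \<le> card (target_preimage U a W2)"
    using bal unfolding balanced_def by auto
  define D where "D = {..<X} \<times> {..<X}"
  define P where "P = {..<U} \<rightarrow>\<^sub>E {..<X}"
  define E where "E = {(f1, f2) \<in> P \<times> P. inj_on f1 {..<U} \<and> inj_on f2 {..<U}}"
  \<comment> \<open>The channel cells hit by message pairs whose target value lies in
    \<open>V\<close>.\<close>
  define I where "I V f = map_prod (fst f) (snd f) ` target_preimage U a V"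
    for V and f :: "(nat \<Rightarrow> nat) \<times> (nat \<Rightarrow> nat)"
  \<comment> \<open>A necessary condition for decodability that no longer mentions the decoder. The
    union bound therefore runs over encoder pairs only and pays nothing for the choice of
    \<open>\<phi>\<close>.\<close>
  define K where "K f = {g \<in> D \<rightarrow>\<^sub>E {..<Y}. g ` I W1 f \<inter> g ` I W2 f = {}}" for f
  have finP: "finite P"
    by (simp add: P_def finite_PiE)
  have finE: "finite E"
    by (rule finite_subset[of _ "P \<times> P"]) (auto simp: E_def finP)
  have finD: "finite D"
    by (simp add: D_def)
  have "card E \<le> card (P \<times> P)"
    by (rule card_mono) (auto simp: E_def finP)
  also have "\<dots> = X ^ (2 * U)"
    by (simp add: card_cartesian_product P_def card_PiE mult_2 power_add)
  finally have cE: "real (card E) \<le> real X ^ (2 * U)"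
    by (metis of_nat_le_iff of_nat_power)
  have channels: "channels X Y = D \<rightarrow>\<^sub>E {..<Y}" "real (card (channels X Y)) = real Y ^ card D"
    by (auto simp: channels_def D_def card_PiE)
  have K: "real (card (K f)) \<le> real Y ^ card D * ?e" if "f \<in> E" for f
  proof -
    obtain f1 f2 where f: "f = (f1, f2)" by fastforce
    \<comment> \<open>Injectivity transfers both the sizes of the two balanced classes and their
      disjointness to the channel cells.\<close>
    have inj: "inj_on (map_prod f1 f2) ({..<U} \<times> {..<U})"
      using that by (auto simp: E_def f intro!: map_prod_inj_on)
    have sub: "target_preimage U a V \<subseteq> {..<U} \<times> {..<U}" for V
      by (auto simp: target_preimage_def)
    have card: "card (I V f) = card (target_preimage U a V)" for V
      unfolding I_def f using inj sub by (simp add: card_image inj_on_subset)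
    have "target_preimage U a W1 \<inter> target_preimage U a W2 = {}"
      using W by (auto simp: target_preimage_def)
    then have disj: "I W1 f \<inter> I W2 f = {}"
      using inj_on_image_Int[OF inj sub sub, of W1 W2] by (simp add: I_def f)
    have ID: "I V f \<subseteq> D" for V
      using that by (auto simp: I_def f E_def P_def D_def target_preimage_def)
    have "real (card (K f)) \<le> real Y ^ card D *
        (((1 + exp (- (real (card (I W2 f)) / Y))) / 2) ^ card (I W1 f) + (1/2) ^ card (I W2 f))"
      unfolding K_def using card_PiE_disjoint_images[OF finD _ _ ID ID disj, of "{..<Y}"] assms(2)
      by (simp add: lessThan_empty_iff)
    also have "\<dots> \<le> real Y ^ card D * ?e"
      using assms N by (intro mult_left_mono disjoint_images_bound) (auto simp: card)
    finally show ?thesis .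
  qed
  have "{g \<in> channels X Y. zero_feasible U W X Y a g} \<subseteq> (\<Union>f\<in>E. K f)"
  proof safe
    fix g assume g: "g \<in> channels X Y" "zero_feasible U W X Y a g"
    obtain f1 f2 \<phi> where f: "f1 \<in> P" "f2 \<in> P" "inj_on f1 {..<U}" "inj_on f2 {..<U}"
      and \<phi>: "\<And>u v. u < U \<Longrightarrow> v < U \<Longrightarrow> \<phi> (g (f1 u, f2 v)) = a (u, v)"
      using zero_feasibleE[OF g(2) rows cols] unfolding P_def by metis
    \<comment> \<open>The decoder sends values seen on class \<open>V\<close> into \<open>V\<close>,
      so a value common to both classes would be decoded into both \<open>W1\<close> and
      \<open>W2\<close>.\<close>
    have sub: "\<phi> ` g ` I V (f1, f2) \<subseteq> V" for V
      using \<phi> by (auto simp: I_def target_preimage_def)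
    have "g ` I W1 (f1, f2) \<inter> g ` I W2 (f1, f2) = {}"
      using sub[of W1] sub[of W2] W by blast
    then have "g \<in> K (f1, f2)"
      using g by (simp add: K_def channels)
    then show "g \<in> (\<Union>f\<in>E. K f)"
      using f by (auto simp: E_def)
  qed
  then have "card {g \<in> channels X Y. zero_feasible U W X Y a g} \<le> card (\<Union>f\<in>E. K f)"
    using finE finD by (intro card_mono) (auto simp: K_def intro!: finite_PiE)
  also have "\<dots> \<le> (\<Sum>f\<in>E. card (K f))"
    using finE by (rule card_UN_le)
  finally have "real (card {g \<in> channels X Y. zero_feasible U W X Y a g}) \<le> (\<Sum>f\<in>E. real (card (K f)))"
    by (subst of_nat_sum[symmetric]) (rule of_nat_mono)
  also have "\<dots> \<le> (\<Sum>f\<in>E. real Y ^ card D * ?e)"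
    by (intro sum_mono K)
  also have "\<dots> = card E * (real Y ^ card D * ?e)"
    by simp
  also have "\<dots> \<le> real X ^ (2 * U) * (real Y ^ card D * ?e)"
    using cE by (intro mult_right_mono) auto
  finally show ?thesis
    using assms(2) by (simp add: channels(2) field_simps)
qed

section \<open>Asymptotics in the number of messages\<close>

lemma eventually_le_powr_of_limsup:
  fixes X :: "nat \<Rightarrow> nat"
  assumes "limsup (\<lambda>U. ereal (ln (real (X U)) / ln (real U))) < L"
    and pos: "\<And>U. U \<ge> 2 \<Longrightarrow> X U > 0"
  obtains k where "ereal k < L" "\<forall>\<^sub>F U in sequentially. real (X U) \<le> real U powr k"
proof -
  \<comment> \<open>A real \<open>k\<close> strictly between the limsup and \<open>L\<close> turns
    the asymptotic bound into an eventual one with a fixed exponent, also when \<open>L\<close> is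
    infinite.\<close>
  obtain k where k: "limsup (\<lambda>U. ereal (ln (real (X U)) / ln (real U))) < ereal k" "ereal k < L"
    using ereal_dense2[OF assms(1)] by blast
  have "\<forall>\<^sub>F U in sequentially. ereal (ln (real (X U)) / ln (real U)) < ereal k"
    using k(1) by (rule Limsup_lessD)
  then have "\<forall>\<^sub>F U in sequentially. real (X U) \<le> real U powr k"
    using eventually_ge_at_top[of 2]
  proof eventually_elim
    case (elim U)
    then have "ln (real (X U)) \<le> k * ln (real U)"
      by (simp add: field_simps)
    then have "exp (ln (real (X U))) \<le> exp (k * ln (real U))"
      by simp
    then show ?case
      using elim pos[of U] by (simp add: powr_def)
  qed
  with k(2) show thesis by (rule that)
qed

theorem theorem2:
  fixes c :: real
    and W X Y :: "nat \<Rightarrow> nat"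
    and a :: "nat \<Rightarrow> nat \<times> nat \<Rightarrow> nat"
  assumes "0 < c" and "c \<le> 1 / 2"
    and "\<And>U. U \<ge> 2 \<Longrightarrow> W U \<ge> 2"
    and "\<And>U. U \<ge> 2 \<Longrightarrow> X U \<ge> 2"
    and "\<And>U. U \<ge> 2 \<Longrightarrow> Y U \<ge> 2"
    and "\<And>U. U \<ge> 2 \<Longrightarrow> W U \<le> U\<^sup>2"
    and "limsup (\<lambda>U. ereal (ln (real (X U)) / ln (real U))) < \<infinity>"
    and "limsup (\<lambda>U. ereal (ln (real (Y U)) / ln (real U))) < 3"
    and "\<And>U. U \<ge> 2 \<Longrightarrow> a U \<in> target_functions U (W U)"
    and "\<And>U. U \<ge> 2 \<Longrightarrow> balanced c U (W U) (a U)"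
    and "\<And>U. U \<ge> 2 \<Longrightarrow> distinct_rows U (a U)"
    and "\<And>U. U \<ge> 2 \<Longrightarrow> distinct_columns U (a U)"
  shows "(\<lambda>U. real (card {g \<in> channels (X U) (Y U). zero_feasible U (W U) (X U) (Y U) (a U) g})
              / real (card (channels (X U) (Y U)))) \<longlonglongrightarrow> 0"
proof -
  obtain k where k: "\<forall>\<^sub>F U in sequentially. real (X U) \<le> real U powr k"
    using eventually_le_powr_of_limsup[OF assms(7)] assms(4)
    by (metis less_le_trans zero_less_numeral)
  obtain s0 where s0: "ereal s0 < 3" "\<forall>\<^sub>F U in sequentially. real (Y U) \<le> real U powr s0"
    using eventually_le_powr_of_limsup[OF assms(8)] assms(5)
    by (metis less_le_trans zero_less_numeral)
  \<comment> \<open>Raising the exponent to at least 2 makes \<open>c * u powr (2 - s)\<close> at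
    most 1, so it lies below both arguments of the minimum in the counting bound. Since
    \<open>s < 3\<close>, the resulting exponent \<open>4 - s\<close> still exceeds 1.\<close>
  define s where "s = max s0 2"
  have s: "2 \<le> s" "s < 3"
    using s0(1) by (auto simp: s_def)
  define r where "r U = real (card {g \<in> channels (X U) (Y U). zero_feasible U (W U) (X U) (Y U) (a U) g})
              / real (card (channels (X U) (Y U)))" for U
  have "\<forall>\<^sub>F U in sequentially.
      r U \<le> 2 * exp (2 * k * (real U * ln (real U)) - c\<^sup>2 / 4 * real U powr (4 - s))"
    using k s0(2) eventually_ge_at_top[of 2]
  proof eventually_elim
    case (elim U)
    define u where "u = real U"
    have u: "u \<ge> 2" and Y0: "real (Y U) > 0"
      using elim assms(5)[of U] by (auto simp: u_def)
    have "real (Y U) \<le> u powr s"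
      using elim(2) u powr_mono[of s0 s u] unfolding s_def u_def by linarith
    then have "c * u\<^sup>2 / u powr s \<le> c * u\<^sup>2 / real (Y U)"
      using assms(1) Y0 u by (intro divide_left_mono mult_pos_pos) auto
    moreover have us: "u\<^sup>2 / u powr s = u powr (2 - s)"
      using u by (simp add: powr_diff)
    ultimately have "c * u powr (2 - s) \<le> c * u\<^sup>2 / real (Y U)"
      by (metis times_divide_eq_right)
    moreover have "c * u powr (2 - s) \<le> 1 * 1"
      using assms(1,2) u s powr_mono[of "2 - s" 0 u] by (intro mult_mono) auto
    ultimately have "c * u\<^sup>2 * (c * u powr (2 - s)) \<le> c * u\<^sup>2 * min (c * u\<^sup>2 / real (Y U)) 1"
      using assms(1) by (intro mult_left_mono) auto
    moreover have "c * u\<^sup>2 * (c * u powr (2 - s)) = c\<^sup>2 * u powr (4 - s)"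
    proof -
      have "u powr (4 - s) = u powr 2 * u powr (2 - s)"
        by (simp add: powr_add[symmetric])
      then show ?thesis
        using u by (simp add: power2_eq_square)
    qed
    ultimately have E: "c\<^sup>2 * u powr (4 - s) \<le> c * u\<^sup>2 * min (c * u\<^sup>2 / real (Y U)) 1"
      by simp
    have "r U \<le> real (X U) ^ (2 * U) * (2 * exp (- (c * u\<^sup>2 * min (c * u\<^sup>2 / real (Y U)) 1 / 4)))"
      unfolding r_def u_def using assms(1,10-12) elim Y0 by (intro card_zero_feasible_le) auto
    also have "\<dots> \<le> exp (2 * k * (u * ln u)) * (2 * exp (- (c\<^sup>2 * u powr (4 - s) / 4)))"
    proof (intro mult_mono)
      \<comment> \<open>The number of encoder pairs costs only \<open>u * ln u\<close> in the
        exponent, because \<open>X U\<close> is polynomially bounded.\<close>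
      have "real (X U) ^ (2 * U) \<le> (u powr k) ^ (2 * U)"
        using elim(1) by (intro power_mono) (auto simp: u_def)
      also have "\<dots> = exp (2 * k * (u * ln u))"
        using u by (simp add: powr_def exp_of_nat_mult[symmetric] u_def mult_ac)
      finally show "real (X U) ^ (2 * U) \<le> exp (2 * k * (u * ln u))" .
    qed (use E in auto)
    also have "\<dots> = 2 * exp (2 * k * (u * ln u) - c\<^sup>2 / 4 * u powr (4 - s))"
      by (simp only: diff_conv_add_uminus exp_add times_divide_eq_left mult.left_commute)
    finally show ?case
      by (simp add: u_def)
  qed
  moreover have "\<forall>\<^sub>F U in sequentially. 0 \<le> r U"
    by (simp add: r_def)
  moreover have "(\<lambda>U. 2 * exp (2 * k * (real U * ln (real U)) - c\<^sup>2 / 4 * real U powr (4 - s))) \<longlonglongrightarrow> 0"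
  proof -
    define d where "d = c\<^sup>2 / 4"
    \<comment> \<open>Writing \<open>4 - s\<close> as \<open>1 + p\<close> with \<open>p > 0\<close>
      exposes that the power of \<open>U\<close> dominates \<open>U * ln U\<close>, whatever the
      sign or size of \<open>k\<close>.\<close>
    define p where "p = 3 - s"
    have "d > 0" "p > 0"
      using assms(1) s by (auto simp: d_def p_def)
    then have "(\<lambda>U. 2 * exp (2 * k * (real U * ln (real U)) - d * real U powr (1 + p))) \<longlonglongrightarrow> 0"
      by real_asymp
    then show ?thesis
      by (simp add: d_def p_def)
  qed
  ultimately have "r \<longlonglongrightarrow> 0"
    by (intro tendsto_sandwich[of "\<lambda>_. 0" r sequentially, OF _ _ tendsto_const])
  then show ?thesis
    unfolding r_def .
qed

end
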